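(* Let $\mathcal{M},\mathcal{N},\mathcal{S}$ be subspaces of $\mathcal{H}$ satisfying the idempotency condition, and let $E=P_{\mathcal{M},\mathcal{N},\mathcal{S}}$. Then the following are equivalent: (i) $E^*$ is idempotent, $\overline{E}=P_{\overline{\mathcal{M}},\overline{\mathcal{N}}}\ \hat{+}\ (\{0\}\times\overline{\mathcal{S}})$, and $\operatorname{ran}\overline{E}$ and $\operatorname{ran}(I-\overline{E})$ are closed; (ii) $\mathcal{M}^{\perp}+\mathcal{N}^{\perp}+\mathcal{S}^{\perp}$ and $\overline{\mathcal{M}+\mathcal{N}}+\overline{\mathcal{S}}$ are closed, and $\overline{\mathcal{M}+\mathcal{N}}\cap\overline{\mathcal{S}}=(\overline{\mathcal{M}}\cap\overline{\mathcal{S}})+(\overline{\mathcal{N}}\cap\overline{\mathcal{S}})$. In this case, $\overline{E}$ is idempotent and $$\overline{E}=P_{\overline{\mathcal{M}}+\overline{\mathcal{N}}\cap\overline{\mathcal{S}},\ \overline{\mathcal{N}}+\overline{\mathcal{M}}\cap\overline{\mathcal{S}},\ \overline{\mathcal{S}}+\overline{\mathcal{M}}\cap\overline{\mathcal{N}}}$$ (in particular, this triplet satisfies the idempotency condition).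
   Context: $\mathcal{H}$ is a complex separable Hilbert space; "subspace" means linear subspace, not necessarily closed. In expressions such as $\mathcal{A}+\mathcal{B}\cap\mathcal{C}$, the intersection is taken first: $\mathcal{A}+(\mathcal{B}\cap\mathcal{C})$. A linear relation on $\mathcal{H}$ is a linear subspace $T$ of $\mathcal{H}\times\mathcal{H}$; its closure $\overline{T}$ is taken in $\mathcal{H}\times\mathcal{H}$; $\operatorname{ran}T=\{y:(x,y)\in T\text{ for some }x\}$; its adjoint is $T^*=\{(x,y)\in\mathcal{H}\times\mathcal{H}:\langle g,x\rangle=\langle f,y\rangle\text{ for all }(f,g)\in T\}$. $I=\{(u,u):u\in\mathcal{H}\}$ and $I-T=\{(x,x-y):(x,y)\in T\}$. Product: $ST=\{(x,y): (x,z)\in T,\ (z,y)\in S \text{ for some } z\}$; $T$ is idempotent if $T^2=TT=T$. $T\,\hat{+}\,S$ is the sum of $T$ and $S$ as subspaces of $\mathcal{H}\times\mathcal{H}$. For subspaces $\mathcal{M},\mathcal{N}$ of $\mathcal{H}$, $P_{\mathcal{M},\mathcal{N}}:=\{(m+n,m): m\in\mathcal{M},\ n\in\mathcal{N}\}$. Subspaces $\mathcal{M},\mathcal{N},\mathcal{S}$ satisfy the idempotency condition if $(\mathcal{M}+\mathcal{N})\cap\mathcal{S}=\mathcal{M}\cap\mathcal{N}$; only in that case one writes $P_{\mathcal{M},\mathcal{N},\mathcal{S}}:=P_{\mathcal{M},\mathcal{N}}\ \hat{+}\ (\{0\}\times\mathcal{S})$. $\mathcal{M}^\perp$ denotes the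 orthogonal complement in $\mathcal{H}$. *)

theory Defs
  imports "HOL-Analysis.Analysis" "HOL-Library.Set_Algebras"
begin

section \<open>Complex separable Hilbert spaces\<close>

text \<open>
  A complex inner product space is a complex vector space whose underlying real inner product is
  the real part of the complex one, so norm and topology are those of the type class
  \<^class>\<open>real_inner\<close>; in particular \<open>norm x = sqrt (Re (cinner x x))\<close>. The product type
  \<open>'a \<times> 'a\<close> carries the Hilbert sum norm and its topology in the library.
  The complex inner product is linear in its first argument.
\<close>

class complex_inner = real_inner +
  fixes scaleC :: "complex \<Rightarrow> 'a \<Rightarrow> 'a"  (infixr "*\<^sub>C" 75)
    and cinner :: "'a \<Rightarrow> 'a \<Rightarrow> complex"
  assumes scaleC_add_right: "a *\<^sub>C (x + y) = a *\<^sub>C x + a *\<^sub>C y"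
    and scaleC_add_left: "(a + b) *\<^sub>C x = a *\<^sub>C x + b *\<^sub>C x"
    and scaleC_scaleC: "a *\<^sub>C (b *\<^sub>C x) = (a * b) *\<^sub>C x"
    and scaleR_scaleC: "r *\<^sub>R x = complex_of_real r *\<^sub>C x"
    and cinner_add_left: "cinner (x + y) z = cinner x z + cinner y z"
    and cinner_scaleC_left: "cinner (a *\<^sub>C x) y = a * cinner x y"
    and cinner_commute: "cinner y x = cnj (cinner x y)"
    and inner_eq_Re_cinner: "x \<bullet> y = Re (cinner x y)"

class separable_chilbert_space = complex_inner + complete_space +
  assumes separable: "\<exists>D. countable D \<and> (\<forall>x. \<forall>e>0. \<exists>d\<in>D. dist d x < e)"

lemma separable_closure:
  "\<exists>D::'a::separable_chilbert_space set. countable D \<and> closure D = UNIV"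
proof -
  obtain D :: "'a set" where "countable D" and "\<forall>x. \<forall>e>0. \<exists>d\<in>D. dist d x < e"
    using separable by blast
  then show ?thesis
    by (auto simp: closure_approachable)
qed

lemma cinner_self: "cinner x x = complex_of_real ((norm x)\<^sup>2)"
proof -
  have "Im (cinner x x) = 0"
    using cinner_commute[of x x] by (metis Reals_cnj_iff complex_is_Real_iff)
  then show ?thesis
    by (simp add: complex_eq_iff power2_norm_eq_inner inner_eq_Re_cinner)
qed

global_interpretation complex_vector:
  vector_space "scaleC :: complex \<Rightarrow> 'a \<Rightarrow> 'a::complex_inner"
proof
  show "1 *\<^sub>C x = x" for x :: 'a
    using scaleR_scaleC[of 1 x] by simp
qed (simp_all add: scaleC_add_right scaleC_add_left scaleC_scaleC)

abbreviation csubspace :: "'a::complex_inner set \<Rightarrow> bool"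
  where "csubspace \<equiv> complex_vector.subspace"

instantiation complex :: separable_chilbert_space
begin

definition scaleC_complex :: "complex \<Rightarrow> complex \<Rightarrow> complex"
  where "scaleC_complex a x = a * x"

definition cinner_complex :: "complex \<Rightarrow> complex \<Rightarrow> complex"
  where "cinner_complex x y = x * cnj y"

instance
proof
  obtain D :: "complex set" where "countable D"
    and D: "\<And>X. open X \<Longrightarrow> X \<noteq> {} \<Longrightarrow> \<exists>d\<in>D. d \<in> X"
    using countable_dense_setE by blast
  have "\<exists>d\<in>D. dist d x < e" if "e > 0" for x :: complex and e :: real
    using D[of "ball x e"] that by (auto simp: dist_commute)
  then show "\<exists>D::complex set. countable D \<and> (\<forall>x. \<forall>e>0. \<exists>d\<in>D. dist d x < e)"
    using \<open>countable D\<close> by blast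
qed (simp_all add: scaleC_complex_def cinner_complex_def algebra_simps scaleR_conv_of_real
       inner_complex_def)

end

definition corth :: "'a::complex_inner set \<Rightarrow> 'a set"
  where "corth M = {x. \<forall>y\<in>M. cinner x y = 0}"

section \<open>Linear relations\<close>

text \<open>
  The library composition \<open>T O S\<close> applies \<open>T\<close> first, hence is the product written \<open>ST\<close> for
  linear relations. The range is \<^const>\<open>Range\<close>, and the sum of relations as subspaces
  of \<open>'a \<times> 'a\<close> is the elementwise \<open>+\<close> of sets.
\<close>

definition idempotent_rel :: "('a \<times> 'a) set \<Rightarrow> bool"
  where "idempotent_rel T \<longleftrightarrow> T O T = T"

definition adjoint_rel :: "('a::complex_inner \<times> 'a) set \<Rightarrow> ('a \<times> 'a) set"
  where "adjoint_rel T = {(x, y). \<forall>(f, g)\<in>T. cinner g x = cinner f y}"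

definition id_minus_rel :: "('a::ab_group_add \<times> 'a) set \<Rightarrow> ('a \<times> 'a) set"
  where "id_minus_rel T = {(x, x - y) |x y. (x, y) \<in> T}"

definition P2 :: "'a::ab_group_add set \<Rightarrow> 'a set \<Rightarrow> ('a \<times> 'a) set"
  where "P2 M N = {(m + n, m) |m n. m \<in> M \<and> n \<in> N}"

definition idempotency_condition :: "'a::ab_group_add set \<Rightarrow> 'a set \<Rightarrow> 'a set \<Rightarrow> bool"
  where "idempotency_condition M N S \<longleftrightarrow> (M + N) \<inter> S = M \<inter> N"

text \<open>Meaningful only for triples satisfying \<^const>\<open>idempotency_condition\<close>.\<close>

definition P3 :: "'a::ab_group_add set \<Rightarrow> 'a set \<Rightarrow> 'a set \<Rightarrow> ('a \<times> 'a) set"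
  where "P3 M N S = P2 M N + {0} \<times> S"

end

theory Submission
  imports Defs
begin

text \<open>
  Write \<open>A, B, C\<close> for the closures of \<open>M, N, S\<close> and \<open>F\<close> for the relation built from \<open>A, B, C\<close>. Always
  \<open>closure E = closure F\<close>, and \<open>F\<close> is the sum of the diagonal copy of \<open>A\<close> and \<open>B \<times> C\<close>. A sum of two
  closed subspaces is closed iff the sum of their orthogonal complements is (open mapping and Riesz),
  which turns closedness of \<open>F\<close> into closedness of \<open>A\<^sup>\<bottom> + B\<^sup>\<bottom> + C\<^sup>\<bottom>\<close>. The adjoint of \<open>E\<close> is
  \<open>{(x, y). x \<in> C\<^sup>\<bottom> \<and> y \<in> B\<^sup>\<bottom> \<and> x - y \<in> A\<^sup>\<bottom>}\<close>, and it is idempotent iff the triple of complements is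
  distributive. By the modular law this is equivalent to the dual identity
  \<open>(C\<^sup>\<bottom> + A\<^sup>\<bottom>) \<inter> (C\<^sup>\<bottom> + B\<^sup>\<bottom>) = C\<^sup>\<bottom> + (A\<^sup>\<bottom> \<inter> B\<^sup>\<bottom>)\<close>, whose orthogonal complement is the identity
  \<open>closure (A + B) \<inter> C = (A \<inter> C) + (B \<inter> C)\<close> as soon as the sums involved are closed.
  Since the underlying real inner product is the real part of the complex one, complex subspaces have
  the same complements for both, so the geometry is carried out in real Hilbert spaces.
\<close>

\<comment> \<open>Lets the results for the sort \<open>{real_inner,banach}\<close> be applied to the
  Hilbert space of the theorem.\<close>
subclass (in separable_chilbert_space) banach ..

section \<open>Orthogonal complements in real Hilbert spaces\<close>

lemma subspace_set_plus:
  assumes "subspace X" "subspace Y"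
  shows "subspace (X + Y)"
proof -
  have "X + Y = {x + y | x y. x \<in> X \<and> y \<in> Y}"
    by (auto simp: set_plus_def)
  then show ?thesis
    using subspace_sums[OF assms] by simp
qed

lemma subspace_closure:
  fixes X :: "'a::real_normed_vector set"
  assumes "subspace X"
  shows "subspace (closure X)"
proof (rule subspaceI)
  show "0 \<in> closure X"
    using assms closure_subset subspace_0 by blast
  show "x + y \<in> closure X" if xy: "x \<in> closure X" "y \<in> closure X" for x y
  proof -
    have "x + y \<in> closure (X + X)"
      using closure_sum xy by blast
    moreover have "X + X \<subseteq> X"
      using assms subspace_sum_minimal by blast
    ultimately show ?thesis
      using closure_mono by blast
  qed
  show "c *\<^sub>R x \<in> closure X" if "x \<in> closure X" for c x
  proof -
    have "c *\<^sub>R x \<in> closure ((*\<^sub>R) c ` X)"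
      using that by (metis closure_scaleR image_eqI)
    moreover have "(*\<^sub>R) c ` X \<subseteq> X"
      using assms subspace_scale by blast
    ultimately show ?thesis
      using closure_mono by blast
  qed
qed

lemma closed_orthogonal_comp: "closed (W\<^sup>\<bottom>)"
proof -
  have "W\<^sup>\<bottom> = (\<Inter>y\<in>W. {x. y \<bullet> x = 0})"
    by (auto simp: orthogonal_comp_def orthogonal_def)
  moreover have "closed {x. y \<bullet> x = 0}" for y :: 'a
    by (intro closed_Collect_eq continuous_intros)
  ultimately show ?thesis
    by auto
qed

text \<open>Orthogonality to one fixed vector is a closed condition, so it extends from
  \<open>W\<close> to its closure.\<close>

lemma orthogonal_comp_closure: "(closure W)\<^sup>\<bottom> = W\<^sup>\<bottom>"
proof
  show "(closure W)\<^sup>\<bottom> \<subseteq> W\<^sup>\<bottom>"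
    by (intro orthogonal_comp_anti_mono closure_subset)
  show "W\<^sup>\<bottom> \<subseteq> (closure W)\<^sup>\<bottom>"
  proof
    fix x assume "x \<in> W\<^sup>\<bottom>"
    then have "W \<subseteq> {x}\<^sup>\<bottom>"
      by (auto simp: orthogonal_comp_def orthogonal_commute)
    then have "closure W \<subseteq> {x}\<^sup>\<bottom>"
      by (intro closure_minimal closed_orthogonal_comp)
    then show "x \<in> (closure W)\<^sup>\<bottom>"
      by (auto simp: orthogonal_comp_def orthogonal_commute)
  qed
qed

lemma orthogonal_comp_sum:
  assumes "0 \<in> X" "0 \<in> Y"
  shows "(X + Y)\<^sup>\<bottom> = X\<^sup>\<bottom> \<inter> Y\<^sup>\<bottom>"
proof -
  have "X \<subseteq> X + Y" "Y \<subseteq> X + Y"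
    using assms by (force simp: set_plus_def)+
  then show ?thesis
    by (fastforce simp: orthogonal_comp_def orthogonal_def inner_left_distrib elim: set_plus_elim)
qed

text \<open>Classical minimization: a sequence in \<open>X\<close> minimizing the distance to
  \<open>x\<close> is Cauchy, and its limit is the nearest point, whose residual is normal to
  \<open>X\<close>.\<close>

lemma closed_subspace_projection:
  fixes X :: "'a::{real_inner,banach} set"
  assumes X: "subspace X" "closed X"
  obtains p where "p \<in> X" "x - p \<in> X\<^sup>\<bottom>"
proof -
  define d where "d = (INF p\<in>X. (norm (x - p))\<^sup>2)"
  have bdd: "bdd_below ((\<lambda>p. (norm (x - p))\<^sup>2) ` X)"
    by (rule bdd_belowI[of _ 0]) auto
  have d: "d \<le> (norm (x - p))\<^sup>2" if "p \<in> X" for p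
    unfolding d_def using bdd that by (rule cINF_lower)
  have "\<exists>p\<in>X. (norm (x - p))\<^sup>2 < d + inverse (Suc n)" for n
    using cINF_less_iff[OF _ bdd, of "d + inverse (Suc n)"] X subspace_0
    by (fastforce simp: d_def)
  then obtain p where p: "p n \<in> X" "(norm (x - p n))\<^sup>2 < d + inverse (Suc n)" for n
    by metis
  have par: "(norm (p m - p n))\<^sup>2 \<le> 2 * inverse (Suc m) + 2 * inverse (Suc n)" for m n
  proof -
    \<comment> \<open>Parallelogram law; the midpoint lies in \<open>X\<close>, so the subtracted
      term is at least \<open>4 * d\<close>.\<close>
    have "(norm (p m - p n))\<^sup>2 = 2 * (norm (x - p m))\<^sup>2 + 2 * (norm (x - p n))\<^sup>2
      - 4 * (norm (x - (1/2) *\<^sub>R (p m + p n)))\<^sup>2"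
      unfolding power2_norm_eq_inner by (simp add: algebra_simps inner_commute)
    moreover have "(1/2) *\<^sub>R (p m + p n) \<in> X"
      using X p by (intro subspace_scale subspace_add)
    ultimately show ?thesis
      using p(2)[of m] p(2)[of n] d by fastforce
  qed
  have "Cauchy p"
  proof (rule metric_CauchyI)
    fix e :: real assume "e > 0"
    then obtain N where N: "inverse (Suc N) < e\<^sup>2 / 4"
      using reals_Archimedean[of "e\<^sup>2 / 4"] by auto
    have "dist (p m) (p n) < e" if "m \<ge> N" "n \<ge> N" for m n
    proof -
      have "inverse (real (Suc m)) \<le> inverse (Suc N)" "inverse (real (Suc n)) \<le> inverse (Suc N)"
        using that by (auto intro!: le_imp_inverse_le)
      then have "(norm (p m - p n))\<^sup>2 < e\<^sup>2"
        using par[of m n] N by linarith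
      then show ?thesis
        using \<open>e > 0\<close> by (simp add: dist_norm power2_less_imp_less)
    qed
    then show "\<exists>N. \<forall>m\<ge>N. \<forall>n\<ge>N. dist (p m) (p n) < e"
      by blast
  qed
  then obtain q where q: "p \<longlonglongrightarrow> q"
    using Cauchy_convergent_iff convergent_def by blast
  have "q \<in> X"
    using X p(1) q closed_sequentially by blast
  have "(\<lambda>n. (norm (x - p n))\<^sup>2) \<longlonglongrightarrow> (norm (x - q))\<^sup>2"
    by (intro tendsto_intros q)
  moreover have "(\<lambda>n. d + inverse (Suc n)) \<longlonglongrightarrow> d + 0"
    using LIMSEQ_inverse_real_of_nat by (intro tendsto_intros) auto
  ultimately have qd: "(norm (x - q))\<^sup>2 \<le> d"
    using LIMSEQ_le p(2) by (metis (no_types, lifting) add.right_neutral less_imp_le)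
  have "y \<bullet> (x - q) = 0" if "y \<in> X" for y
  proof (cases "y = 0")
    case False
    \<comment> \<open>The minimizer of the quadratic
      \<open>t \<mapsto> (norm (x - (q + t *\<^sub>R y)))\<^sup>2\<close>.\<close>
    define t where "t = (y \<bullet> (x - q)) / (y \<bullet> y)"
    have "q + t *\<^sub>R y \<in> X"
      using X that \<open>q \<in> X\<close> by (simp add: subspace_add subspace_scale)
    then have "(norm (x - q))\<^sup>2 \<le> (norm (x - (q + t *\<^sub>R y)))\<^sup>2"
      using d qd order_trans by blast
    also have "\<dots> = (norm (x - q))\<^sup>2 - 2 * t * (y \<bullet> (x - q)) + t * (t * (y \<bullet> y))"
      unfolding power2_norm_eq_inner by (simp add: algebra_simps inner_commute)
    also have "t * (y \<bullet> y) = y \<bullet> (x - q)"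
      using False by (simp add: t_def)
    finally have "(y \<bullet> (x - q))\<^sup>2 / (y \<bullet> y) \<le> 0"
      by (simp add: t_def power2_eq_square)
    moreover have "y \<bullet> y > 0"
      using False by simp
    ultimately show ?thesis
      by (auto simp: divide_le_0_iff)
  qed simp
  then show thesis
    using that \<open>q \<in> X\<close> by (simp add: orthogonal_comp_def orthogonal_def)
qed

text \<open>If \<open>x\<close> lies in the double complement and \<open>p\<close> is its projection
  on \<open>closure X\<close>, then \<open>x - p\<close> is orthogonal to both \<open>x\<close> and
  \<open>p\<close>, hence to itself.\<close>

lemma orthogonal_comp_orthogonal_comp:
  fixes X :: "'a::{real_inner,banach} set"
  assumes "subspace X"
  shows "X\<^sup>\<bottom>\<^sup>\<bottom> = closure X"
proof
  show "closure X \<subseteq> X\<^sup>\<bottom>\<^sup>\<bottom>"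
    by (intro closure_minimal orthogonal_comp_subset closed_orthogonal_comp)
  show "X\<^sup>\<bottom>\<^sup>\<bottom> \<subseteq> closure X"
  proof
    fix x assume x: "x \<in> X\<^sup>\<bottom>\<^sup>\<bottom>"
    obtain p where p: "p \<in> closure X" "x - p \<in> (closure X)\<^sup>\<bottom>"
      using closed_subspace_projection subspace_closure[OF assms] by (metis closed_closure)
    have "(x - p) \<bullet> x = 0"
      using p x by (simp add: orthogonal_comp_closure) (simp add: orthogonal_comp_def orthogonal_def)
    moreover have "(x - p) \<bullet> p = 0"
      using p by (simp add: orthogonal_comp_def orthogonal_def inner_commute)
    ultimately have "(x - p) \<bullet> (x - p) = 0"
      by (simp add: inner_diff_right)
    then show "x \<in> closure X"
      using p by simp
  qed
qed

section \<open>Closed sums of closed subspaces\<close>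

text \<open>The Baire half of the open mapping argument. The complete space \<open>X + Y\<close> is
  covered by the closures of the sets \<open>U n\<close>, so one of these has a relative interior
  point \<open>w0\<close>; differences of vectors near \<open>w0\<close> then give approximate
  decompositions with a uniform bound.\<close>

lemma closed_subspace_sum_approximation:
  fixes X Y :: "'a::banach set"
  assumes X: "subspace X" and Y: "subspace Y" and "closed (X + Y)"
  obtains c where "\<And>w e. w \<in> X + Y \<Longrightarrow> e > 0
    \<Longrightarrow> \<exists>x\<in>X. \<exists>y\<in>Y. norm x \<le> c * norm w \<and> norm (w - x - y) < e"
proof -
  define W where "W = X + Y"
  define U where "U n = {x + y | x y. x \<in> X \<and> y \<in> Y \<and> norm x \<le> real n}" for n
  have W: "subspace W" "closed W"
    using assms subspace_set_plus by (auto simp: W_def)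
  have UW: "closure (U n) \<subseteq> W" for n
    using W by (intro closure_minimal) (auto simp: U_def W_def)
  have "w \<in> (\<Union>n. closure (U n))" if w: "w \<in> W" for w
  proof -
    obtain x y where xy: "w = x + y" "x \<in> X" "y \<in> Y"
      using w by (auto simp: W_def set_plus_def)
    obtain n where "norm x \<le> real n"
      using real_arch_simple by blast
    then have "w \<in> U n"
      using xy by (auto simp: U_def)
    then show ?thesis
      using closure_subset by blast
  qed
  then have "(\<Union>n. closure (U n)) = W"
    using UW by blast
  then have "top_of_set W interior_of (\<Union>n. closure (U n)) = W"
    by (metis interior_of_topspace topspace_euclidean_subtopology)
  moreover have "W \<noteq> {}"
    using W subspace_0 by blast
  moreover have "completely_metrizable_space (top_of_set W)"
    using completely_metrizable_space_closedin[OF completely_metrizable_space_euclidean] W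
    by (metis closed_closedin)
  ultimately have "\<not> (\<forall>T\<in>range (\<lambda>n. closure (U n)).
      closedin (top_of_set W) T \<and> top_of_set W interior_of T = {})"
    using Baire_category_alt[of "top_of_set W" "range (\<lambda>n. closure (U n))"] by auto
  moreover have "closedin (top_of_set W) (closure (U n))" for n
    using UW closed_subset by blast
  ultimately obtain n where "top_of_set W interior_of (closure (U n)) \<noteq> {}"
    by blast
  then obtain w0 T where T: "open T" "w0 \<in> T" "w0 \<in> W" "W \<inter> T \<subseteq> closure (U n)"
    by (auto simp: interior_of_def openin_open) 
  then obtain r where r: "r > 0" "ball w0 r \<subseteq> T"
    using open_contains_ball by blast
  have near: "\<exists>x\<in>X. \<exists>y\<in>Y. norm x \<le> real n \<and> norm (w - x - y) < e"
    if "w \<in> W" "norm (w - w0) < r" "e > 0" for w e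
  proof -
    have "w \<in> closure (U n)"
      using that T r by (auto simp: dist_norm norm_minus_commute)
    then obtain u where "u \<in> U n" "dist u w < e"
      using \<open>e > 0\<close> closure_approachable by blast
    then show ?thesis
      by (fastforce simp: U_def dist_norm norm_minus_commute diff_diff_add)
  qed
  show thesis
  proof (rule that[of "4 * real n / r"])
    fix w :: 'a and e :: real
    assume "w \<in> X + Y" "e > 0"
    then have "w \<in> W"
      by (simp add: W_def)
    show "\<exists>x\<in>X. \<exists>y\<in>Y. norm x \<le> 4 * real n / r * norm w \<and> norm (w - x - y) < e"
    proof (cases "w = 0")
      case True
      then show ?thesis
        using X Y \<open>e > 0\<close> by (intro bexI[of _ 0]) (auto simp: subspace_0)
    next
      case False
      \<comment> \<open>Makes \<open>t *\<^sub>R w\<close> a vector of norm \<open>r / 2\<close>, so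
        \<open>w0 + t *\<^sub>R w\<close> stays in the ball about \<open>w0\<close>.\<close>
      define t where "t = r / (2 * norm w)"
      have "t > 0"
        using False r by (simp add: t_def)
      have "w0 + t *\<^sub>R w \<in> W" "norm (w0 + t *\<^sub>R w - w0) < r"
        using W T \<open>w \<in> W\<close> False r by (simp_all add: t_def subspace_add subspace_scale)
      then obtain x1 y1 where 1: "x1 \<in> X" "y1 \<in> Y" "norm x1 \<le> n"
          "norm (w0 + t *\<^sub>R w - x1 - y1) < e * t / 2"
        using near[of "w0 + t *\<^sub>R w" "e * t / 2"] \<open>t > 0\<close> \<open>e > 0\<close> by auto
      obtain x2 y2 where 2: "x2 \<in> X" "y2 \<in> Y" "norm x2 \<le> n" "norm (w0 - x2 - y2) < e * t / 2"
        using near[of w0 "e * t / 2"] \<open>t > 0\<close> \<open>e > 0\<close> T r by auto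
      \<comment> \<open>Subtracting the two approximations cancels \<open>w0\<close>, and dividing
        by \<open>t\<close> recovers \<open>w\<close>. The bound \<open>2 * n / t\<close> is
        \<open>4 * n / r * norm w\<close>.\<close>
      define x y where "x = (1 / t) *\<^sub>R (x1 - x2)" and "y = (1 / t) *\<^sub>R (y1 - y2)"
      have "x \<in> X" "y \<in> Y"
        using 1 2 X Y by (auto simp: x_def y_def intro: subspace_scale subspace_diff)
      moreover have "norm x \<le> 4 * real n / r * norm w"
      proof -
        have "norm (x1 - x2) \<le> 2 * n"
          using 1 2 norm_triangle_ineq4[of x1 x2] by linarith
        then have "norm x \<le> (1 / t) * (2 * n)"
          unfolding x_def norm_scaleR using \<open>t > 0\<close> by (intro mult_mono) auto
        then show ?thesis
          by (simp add: t_def ac_simps)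
      qed
      moreover have "norm (w - x - y) < e"
      proof -
        have "t *\<^sub>R (w - x - y) = (w0 + t *\<^sub>R w - x1 - y1) - (w0 - x2 - y2)"
          using \<open>t > 0\<close> by (simp add: x_def y_def algebra_simps)
        then have "t * norm (w - x - y) = norm ((w0 + t *\<^sub>R w - x1 - y1) - (w0 - x2 - y2))"
          using \<open>t > 0\<close> by (metis abs_of_pos norm_scaleR)
        also have "\<dots> < t * e"
          using 1(4) 2(4) norm_triangle_ineq4[of "w0 + t *\<^sub>R w - x1 - y1" "w0 - x2 - y2"]
          by (simp add: mult.commute)
        finally show ?thesis
          using \<open>t > 0\<close> by simp
      qed
      ultimately show ?thesis
        by blast
    qed
  qed
qed

text \<open>The iteration behind the open mapping theorem, applied to the addition map of
  \<open>X \<times> Y\<close> onto \<open>X + Y\<close>.\<close>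

lemma closed_subspace_sum_bounded_decomposition:
  fixes X Y :: "'a::banach set"
  assumes X: "subspace X" "closed X" and Y: "subspace Y" "closed Y" and XY: "closed (X + Y)"
  obtains c where "\<And>w. w \<in> X + Y \<Longrightarrow> \<exists>x\<in>X. w - x \<in> Y \<and> norm x \<le> c * norm w"
proof -
  have W: "subspace (X + Y)"
    using X Y subspace_set_plus by blast
  obtain c where c: "\<And>w e. w \<in> X + Y \<Longrightarrow> e > 0
      \<Longrightarrow> \<exists>x\<in>X. \<exists>y\<in>Y. norm x \<le> c * norm w \<and> norm (w - x - y) < e"
    using closed_subspace_sum_approximation[OF X(1) Y(1) XY] by blast
  \<comment> \<open>The tolerance \<open>norm w / 2\<close> makes each correction at least halve the
    remainder; it is positive only for nonzero \<open>w\<close>.\<close>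
  have "\<exists>x\<in>X. \<exists>y\<in>Y. norm x \<le> c * norm w \<and> norm (w - x - y) \<le> norm w / 2" if "w \<in> X + Y" for w
  proof (cases "w = 0")
    case True
    then show ?thesis
      using X Y by (intro bexI[of _ 0]) (auto simp: subspace_0)
  next
    case False
    then show ?thesis
      using c[OF that, of "norm w / 2"] by (meson half_gt_zero less_imp_le zero_less_norm_iff)
  qed
  then obtain f g where fg: "f w \<in> X" "g w \<in> Y" "norm (f w) \<le> c * norm w"
      "norm (w - f w - g w) \<le> norm w / 2" if "w \<in> X + Y" for w
    by metis
  show thesis
  \<comment> \<open>The 2 is the sum of the geometric series of ratio 1/2; the absolute value makes
    the constant nonnegative, so bounds may be multiplied by it.\<close>
  proof (rule that[of "2 * \<bar>c\<bar>"])
    fix w assume w: "w \<in> X + Y"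
    \<comment> \<open>\<open>v k\<close> is what remains of \<open>w\<close> after \<open>k\<close>
      corrections.\<close>
    define v where "v k = ((\<lambda>u. u - f u - g u) ^^ k) w" for k
    have v_Suc: "v (Suc k) = v k - f (v k) - g (v k)" for k
      by (simp add: v_def)
    have v_in: "v k \<in> X + Y" for k
    proof (induction k)
      case (Suc k)
      then have "f (v k) + g (v k) \<in> X + Y"
        using fg by blast
      then show ?case
        using W Suc subspace_diff[of "X + Y" "v k" "f (v k) + g (v k)"]
        by (simp add: v_Suc diff_diff_add)
    qed (simp add: v_def w)
    have v_le: "norm (v k) \<le> norm w * (1/2) ^ k" for k
    proof (induction k)
      case (Suc k)
      then show ?case
        using fg(4)[OF v_in[of k]] by (simp add: v_Suc)
    qed (simp add: v_def)
    have f_le: "norm (f (v k)) \<le> \<bar>c\<bar> * norm w * (1/2) ^ k" for k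
    proof -
      have "norm (f (v k)) \<le> \<bar>c\<bar> * norm (v k)"
        using fg(3)[OF v_in[of k]] by (smt (verit) mult_right_mono norm_ge_zero)
      also have "\<dots> \<le> \<bar>c\<bar> * (norm w * (1/2) ^ k)"
        by (intro mult_left_mono v_le) auto
      finally show ?thesis
        by (simp add: mult.assoc)
    qed
    have sums: "(\<lambda>k. \<bar>c\<bar> * norm w * (1/2) ^ k) sums (\<bar>c\<bar> * norm w * 2)"
      using geometric_sums[of "1/2::real"] by (intro sums_mult) simp
    then have "summable (\<lambda>k. norm (f (v k)))"
      by (rule summable_comparison_test'[OF sums_summable, where N = 0]) (simp add: f_le)
    then have f_summable: "summable (\<lambda>k. f (v k))"
      by (rule summable_norm_cancel)
    define x where "x = (\<Sum>k. f (v k))"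
    have partial: "(\<lambda>n. \<Sum>k<n. f (v k)) \<longlonglongrightarrow> x"
      using f_summable by (simp add: x_def summable_LIMSEQ)
    have "x \<in> X"
      by (intro closed_sequentially[OF X(2) _ partial] subspace_sum X(1) fg(1) v_in)
    moreover have "norm x \<le> 2 * \<bar>c\<bar> * norm w"
    proof -
      have "norm x \<le> (\<Sum>k. norm (f (v k)))"
        unfolding x_def using \<open>summable (\<lambda>k. norm (f (v k)))\<close> by (rule summable_norm)
      also have "\<dots> \<le> (\<Sum>k. \<bar>c\<bar> * norm w * (1/2) ^ k)"
        using f_le \<open>summable (\<lambda>k. norm (f (v k)))\<close> sums by (intro suminf_le) (auto simp: sums_iff)
      finally show ?thesis
        using sums by (simp add: sums_iff ac_simps)
    qed
    moreover have "w - x \<in> Y"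
    proof -
      have decomp: "(\<Sum>k<n. g (v k)) = w - v n - (\<Sum>k<n. f (v k))" for n
        by (induction n) (simp_all add: v_Suc algebra_simps, simp add: v_def)
      have "v \<longlonglongrightarrow> 0"
      proof (rule Lim_null_comparison)
        show "\<forall>\<^sub>F k in sequentially. norm (v k) \<le> norm w * (1/2) ^ k"
          using v_le by simp
        show "(\<lambda>k. norm w * (1/2) ^ k) \<longlonglongrightarrow> 0"
          by (intro tendsto_mult_right_zero LIMSEQ_realpow_zero) auto
      qed
      then have "(\<lambda>n. w - v n - (\<Sum>k<n. f (v k))) \<longlonglongrightarrow> w - 0 - x"
        by (intro tendsto_intros partial)
      then have lim: "(\<lambda>n. \<Sum>k<n. g (v k)) \<longlonglongrightarrow> w - x"
        by (simp add: decomp)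
      show ?thesis
        by (intro closed_sequentially[OF Y(2) _ lim] subspace_sum Y(1) fg(2) v_in)
    qed
    ultimately show "\<exists>x\<in>X. w - x \<in> Y \<and> norm x \<le> 2 * \<bar>c\<bar> * norm w"
      by blast
  qed
qed

text \<open>Continuity of the functional \<open>x + y \<mapsto> z \<bullet> x\<close> in disguise:
  the bounded decomposition gives \<open>k n - w\<close> an \<open>X\<close>-part \<open>d n\<close>
  tending to 0, while \<open>z \<bullet> d n\<close> is constant.\<close>

lemma closed_subspace_sum_hyperplane:
  fixes X Y :: "'a::{real_inner,banach} set"
  assumes X: "subspace X" "closed X" and Y: "subspace Y" "closed Y" and XY: "closed (X + Y)"
    and z: "z \<in> (X \<inter> Y)\<^sup>\<bottom>"
  shows "closed (X \<inter> {z}\<^sup>\<bottom> + Y)"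
proof (subst closed_sequential_limits, intro allI impI)
  fix k w
  assume "(\<forall>n. k n \<in> X \<inter> {z}\<^sup>\<bottom> + Y) \<and> k \<longlonglongrightarrow> w"
  then have k: "\<And>n. k n \<in> X \<inter> {z}\<^sup>\<bottom> + Y" and kw: "k \<longlonglongrightarrow> w"
    by auto
  obtain c where c: "\<And>w. w \<in> X + Y \<Longrightarrow> \<exists>x\<in>X. w - x \<in> Y \<and> norm x \<le> c * norm w"
    using closed_subspace_sum_bounded_decomposition[OF X Y XY] by blast
  have W: "subspace (X + Y)"
    using X Y subspace_set_plus by blast
  have kW: "k n \<in> X + Y" for n
    using k[of n] by (auto simp: set_plus_def)
  then have "w \<in> X + Y"
    using XY kw closed_sequentially by blast
  then obtain x y where w: "w = x + y" "x \<in> X" "y \<in> Y"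
    by (auto simp: set_plus_def)
  have "\<exists>d\<in>X. k n - w - d \<in> Y \<and> norm d \<le> c * norm (k n - w)" for n
    using c W kW \<open>w \<in> X + Y\<close> subspace_diff by blast
  then obtain d where d: "d n \<in> X" "k n - w - d n \<in> Y" "norm (d n) \<le> c * norm (k n - w)" for n
    by metis
  \<comment> \<open>Two \<open>X\<close>-parts of the same vector differ by an element of
    \<open>X \<inter> Y\<close>, on which \<open>z\<close> vanishes. So \<open>z\<close> takes on
    \<open>d n\<close> its value for \<open>k n\<close>, which is 0, minus its value for
    \<open>w\<close>.\<close>
  have "z \<bullet> d n = - (z \<bullet> x)" for n
  proof -
    obtain x' y' where x': "k n = x' + y'" "x' \<in> X" "z \<bullet> x' = 0" "y' \<in> Y"
      using k[of n] by (auto simp: set_plus_def orthogonal_comp_def orthogonal_def)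
    have "x' - x - d n \<in> X"
      using X d w x' by (simp add: subspace_diff)
    moreover have "x' - x - d n = (k n - w - d n) + y - y'"
      using w x' by simp
    then have "x' - x - d n \<in> Y"
      using Y d(2)[of n] w(3) x'(4) by (metis subspace_diff subspace_add)
    ultimately have "x' - x - d n \<in> X \<inter> Y"
      by blast
    then have "(x' - x - d n) \<bullet> z = 0"
      using z unfolding orthogonal_comp_def orthogonal_def by blast
    then show ?thesis
      using x' by (simp add: inner_diff_left inner_diff_right inner_commute[of _ z])
  qed
  moreover have "d \<longlonglongrightarrow> 0"
  proof (rule Lim_null_comparison)
    show "\<forall>\<^sub>F n in sequentially. norm (d n) \<le> c * norm (k n - w)"
      using d by simp
    have "(\<lambda>n. c * norm (k n - w)) \<longlonglongrightarrow> c * norm (w - w)"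
      by (intro tendsto_intros kw)
    then show "(\<lambda>n. c * norm (k n - w)) \<longlonglongrightarrow> 0"
      by simp
  qed
  then have "(\<lambda>n. z \<bullet> d n) \<longlonglongrightarrow> z \<bullet> 0"
    by (intro tendsto_intros)
  ultimately have "z \<bullet> x = 0"
    by (simp add: LIMSEQ_const_iff)
  then show "w \<in> X \<inter> {z}\<^sup>\<bottom> + Y"
    using w by (auto simp: orthogonal_comp_def orthogonal_def)
qed

text \<open>Riesz representation of the functional \<open>x + y \<mapsto> \<langle>z, x\<rangle>\<close> on \<open>X + Y\<close>, which is well defined
  since \<open>z\<close> is orthogonal to \<open>X \<inter> Y\<close>; its kernel is \<open>X \<inter> {z}\<^sup>\<bottom> + Y\<close>.\<close>

lemma orthogonal_comp_Int:
  fixes X Y :: "'a::{real_inner,banach} set"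
  assumes X: "subspace X" "closed X" and Y: "subspace Y" "closed Y" and XY: "closed (X + Y)"
  shows "(X \<inter> Y)\<^sup>\<bottom> = X\<^sup>\<bottom> + Y\<^sup>\<bottom>"
proof
  show "X\<^sup>\<bottom> + Y\<^sup>\<bottom> \<subseteq> (X \<inter> Y)\<^sup>\<bottom>"
    by (intro subspace_sum_minimal orthogonal_comp_anti_mono subspace_orthogonal_comp) auto
  show "(X \<inter> Y)\<^sup>\<bottom> \<subseteq> X\<^sup>\<bottom> + Y\<^sup>\<bottom>"
  proof
    fix z assume z: "z \<in> (X \<inter> Y)\<^sup>\<bottom>"
    show "z \<in> X\<^sup>\<bottom> + Y\<^sup>\<bottom>"
    proof (cases "z \<in> X\<^sup>\<bottom>")
      case True
      then show ?thesis
        using set_plus_intro[OF True subspace_0[OF subspace_orthogonal_comp]] by simp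
    next
      case False
      then obtain x1 where x1: "x1 \<in> X" "z \<bullet> x1 \<noteq> 0"
        by (auto simp: orthogonal_comp_def orthogonal_def inner_commute)
      define K where "K = X \<inter> {z}\<^sup>\<bottom> + Y"
      have K: "subspace K" "closed K"
        unfolding K_def using closed_subspace_sum_hyperplane[OF X Y XY z]
        by (auto intro!: subspace_set_plus subspace_inter X Y subspace_orthogonal_comp)
      have YK: "Y \<subseteq> K"
        using set_plus_intro[OF subspace_0[OF subspace_inter[OF X(1) subspace_orthogonal_comp]]]
        by (fastforce simp: K_def)
      have XK: "x \<in> K" if "x \<in> X" "z \<bullet> x = 0" for x
      proof -
        have "x \<in> X \<inter> {z}\<^sup>\<bottom>"
          using that by (simp add: orthogonal_comp_def orthogonal_def)
        then show ?thesis
          using set_plus_intro[OF _ subspace_0[OF Y(1)]] by (fastforce simp: K_def)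
      qed
      have "x1 \<notin> K"
      proof
        assume "x1 \<in> K"
        then obtain x' y' where x': "x1 = x' + y'" "x' \<in> X" "z \<bullet> x' = 0" "y' \<in> Y"
          by (auto simp: K_def set_plus_def orthogonal_comp_def orthogonal_def)
        then have "y' \<in> X"
          using X x1 by (metis add_diff_cancel_left' subspace_diff)
        then have "z \<bullet> y' = 0"
          using z x' by (simp add: orthogonal_comp_def orthogonal_def inner_commute)
        then show False
          using x1 x' by (simp add: inner_add_right)
      qed
      obtain p where p: "p \<in> K" "x1 - p \<in> K\<^sup>\<bottom>"
        using closed_subspace_projection[OF K] by blast
      define u where "u = x1 - p"
      have "u \<noteq> 0"
        using p \<open>x1 \<notin> K\<close> by (auto simp: u_def)
      have uK: "u \<bullet> k = 0" if "k \<in> K" for k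
        using p(2) that by (simp add: u_def orthogonal_comp_def orthogonal_def inner_commute)
      have ux1: "u \<bullet> x1 = u \<bullet> u"
        using uK[OF p(1)] by (simp add: u_def inner_diff_right)
      \<comment> \<open>The Riesz vector: the normal \<open>u\<close> of the kernel, scaled to agree
        with \<open>z\<close> at \<open>x1\<close>.\<close>
      define v where "v = ((z \<bullet> x1) / (u \<bullet> u)) *\<^sub>R u"
      have "v \<in> Y\<^sup>\<bottom>"
        using uK YK by (auto simp: v_def orthogonal_comp_def orthogonal_def inner_commute)
      moreover have "z - v \<in> X\<^sup>\<bottom>"
      proof -
        have "v \<bullet> x = z \<bullet> x" if "x \<in> X" for x
        proof -
          \<comment> \<open>This combination is chosen so that \<open>z\<close> annihilates it; it
            therefore lies in the kernel and is orthogonal to \<open>u\<close>.\<close>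
          have "(z \<bullet> x1) *\<^sub>R x - (z \<bullet> x) *\<^sub>R x1 \<in> K"
            using X x1 that by (intro XK subspace_diff subspace_scale) (auto simp: inner_diff_right)
          then have "(z \<bullet> x1) * (u \<bullet> x) = (z \<bullet> x) * (u \<bullet> u)"
            using uK[of "(z \<bullet> x1) *\<^sub>R x - (z \<bullet> x) *\<^sub>R x1"] by (simp add: inner_diff_right ux1)
          then show ?thesis
            using \<open>u \<noteq> 0\<close> by (simp add: v_def)
        qed
        then show ?thesis
          by (simp add: orthogonal_comp_def orthogonal_def inner_commute inner_diff_right)
      qed
      ultimately show ?thesis
        using set_plus_intro[of "z - v" _ v] by simp
    qed
  qed
qed

text \<open>If \<open>X + Y\<close> is closed, the sum of complements is itself a complement, hence
  closed. The converse is the same fact for the complements, by double complementation.\<close>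

lemma closed_orthogonal_comp_sum_iff:
  fixes X Y :: "'a::{real_inner,banach} set"
  assumes X: "subspace X" "closed X" and Y: "subspace Y" "closed Y"
  shows "closed (X\<^sup>\<bottom> + Y\<^sup>\<bottom>) \<longleftrightarrow> closed (X + Y)"
proof -
  have *: "closed (U\<^sup>\<bottom> + V\<^sup>\<bottom>)" if "subspace U" "closed U" "subspace V" "closed V" "closed (U + V)"
    for U V :: "'a set"
    using orthogonal_comp_Int[OF that] closed_orthogonal_comp by metis
  show ?thesis
    using *[OF X Y] *[of "X\<^sup>\<bottom>" "Y\<^sup>\<bottom>"] X Y
    by (auto simp: subspace_orthogonal_comp closed_orthogonal_comp orthogonal_comp_orthogonal_comp)
qed

lemma orthogonal_comp_closed_subspace:
  fixes X :: "'a::{real_inner,banach} set"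
  assumes "subspace X" "closed X"
  shows "X\<^sup>\<bottom>\<^sup>\<bottom> = X"
  using assms by (simp add: orthogonal_comp_orthogonal_comp)

section \<open>Distributive triples of subspaces\<close>

text \<open>Forward: from \<open>c + a = c' + b\<close>, split \<open>a - b\<close> as
  \<open>a' + b'\<close> and move \<open>a'\<close> into the \<open>C\<close>-part, leaving
  \<open>a - a' = b + b'\<close> in \<open>A \<inter> B\<close>. Backward: for
  \<open>x = a + b\<close> in \<open>C\<close>, the vector \<open>a = x - b\<close> lies in both
  sums, and its splitting \<open>c + k\<close> gives \<open>x = c + (b + k)\<close>.\<close>

lemma subspace_dual_distributive_iff:
  assumes A: "subspace A" and B: "subspace B" and C: "subspace C"
  shows "(A + B) \<inter> C = (A \<inter> C) + (B \<inter> C) \<longleftrightarrow> (C + A) \<inter> (C + B) = C + (A \<inter> B)"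
proof
  assume *: "(A + B) \<inter> C = (A \<inter> C) + (B \<inter> C)"
  have "x \<in> C + (A \<inter> B)" if x: "x \<in> (C + A) \<inter> (C + B)" for x
  proof -
    obtain c a where "x = c + a" "c \<in> C" "a \<in> A"
      using x by (auto simp: set_plus_def)
    moreover obtain c' b where "x = c' + b" "c' \<in> C" "b \<in> B"
      using x by (auto simp: set_plus_def)
    ultimately have x: "x = c + a" "x = c' + b" "c \<in> C" "a \<in> A" "c' \<in> C" "b \<in> B"
      by blast+
    have eq: "a - b = c' - c"
      using x by (simp add: algebra_simps)
    have "a + - b \<in> A + B"
      using x B by (intro set_plus_intro) (auto simp: subspace_neg)
    moreover have "a + - b \<in> C"
      using x C eq by (simp add: subspace_diff)
    ultimately obtain a' b' where ab: "a - b = a' + b'" "a' \<in> A \<inter> C" "b' \<in> B \<inter> C"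
      using * by (auto simp: set_plus_def) blast
    have "a - a' = b + b'"
      using ab by (simp add: algebra_simps)
    then have "a - a' \<in> A \<inter> B"
      using A B x ab by (metis IntD1 IntI subspace_add subspace_diff)
    moreover have "c + a' \<in> C"
      using C x ab by (simp add: subspace_add)
    ultimately show ?thesis
      using set_plus_intro[of "c + a'" C "a - a'"] x by simp
  qed
  moreover have "C + (A \<inter> B) \<subseteq> (C + A) \<inter> (C + B)"
    by (auto simp: set_plus_def)
  ultimately show "(C + A) \<inter> (C + B) = C + (A \<inter> B)"
    by blast
next
  assume *: "(C + A) \<inter> (C + B) = C + (A \<inter> B)"
  have "x \<in> (A \<inter> C) + (B \<inter> C)" if x: "x \<in> (A + B) \<inter> C" for x
  proof -
    obtain a b where ab: "x = a + b" "a \<in> A" "b \<in> B" "x \<in> C"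
      using x by (auto simp: set_plus_def)
    have "0 + a \<in> C + A"
      using subspace_0[OF C] ab(2) by (rule set_plus_intro)
    moreover have "x + - b \<in> C + B"
      using ab(4) subspace_neg[OF B ab(3)] by (rule set_plus_intro)
    ultimately have "a \<in> C + (A \<inter> B)"
      using * ab by auto
    then obtain c k where ck: "a = c + k" "c \<in> C" "k \<in> A" "k \<in> B"
      by (auto simp: set_plus_def)
    have "c \<in> A \<inter> C"
      using A ab ck by (metis IntI add_diff_cancel_right' subspace_diff)
    moreover have "b + k = x - c"
      using ab ck by (simp add: algebra_simps)
    then have "b + k \<in> B \<inter> C"
      using B C ab ck by (metis IntI subspace_add subspace_diff)
    ultimately show ?thesis
      using set_plus_intro[of c _ "b + k"] ab ck by (simp add: algebra_simps)
  qed
  moreover have "(A \<inter> C) + (B \<inter> C) \<subseteq> (A + B) \<inter> C"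
    using C by (auto simp: set_plus_def subspace_add)
  ultimately show "(A + B) \<inter> C = (A \<inter> C) + (B \<inter> C)"
    by blast
qed

lemma subspace_absorb_sum:
  assumes "subspace A" shows "A + A = A"
  using assms subspace_sum_minimal[of A A A] set_plus_intro[OF _ subspace_0[of A]] by fastforce

text \<open>Closed sums allow intersections and sums to be exchanged under complements, turning the
  dual distributive identity into the one for \<open>V\<close> and \<open>C\<close>. The closedness
  of \<open>A + C\<close> and \<open>B + C\<close> is what the two range conditions amount
  to.\<close>

lemma distributive_complements_iff:
  fixes A B C :: "'a::{real_inner,banach} set"
  assumes A: "subspace A" "closed A" and B: "subspace B" "closed B" and C: "subspace C" "closed C"
    and closed_sum: "closed (A\<^sup>\<bottom> + B\<^sup>\<bottom> + C\<^sup>\<bottom>)"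
  shows "(A\<^sup>\<bottom> + B\<^sup>\<bottom>) \<inter> C\<^sup>\<bottom> = (A\<^sup>\<bottom> \<inter> C\<^sup>\<bottom>) + (B\<^sup>\<bottom> \<inter> C\<^sup>\<bottom>) \<and> closed (A + C) \<and> closed (B + C) \<longleftrightarrow>
    closed (closure (A + B) + C) \<and> closure (A + B) \<inter> C = (A \<inter> C) + (B \<inter> C)"
    (is "?L \<longleftrightarrow> ?R")
proof -
  define V where "V = closure (A + B)"
  have V: "subspace V" "closed V"
    using A B by (simp_all add: V_def subspace_closure subspace_set_plus)
  have V': "V\<^sup>\<bottom> = A\<^sup>\<bottom> \<inter> B\<^sup>\<bottom>"
    using A B by (simp add: V_def orthogonal_comp_closure orthogonal_comp_sum subspace_0)
  have dual_iff: "(A\<^sup>\<bottom> + B\<^sup>\<bottom>) \<inter> C\<^sup>\<bottom> = (A\<^sup>\<bottom> \<inter> C\<^sup>\<bottom>) + (B\<^sup>\<bottom> \<inter> C\<^sup>\<bottom>) \<longleftrightarrow>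
      (C\<^sup>\<bottom> + A\<^sup>\<bottom>) \<inter> (C\<^sup>\<bottom> + B\<^sup>\<bottom>) = V\<^sup>\<bottom> + C\<^sup>\<bottom>"
    by (simp add: subspace_dual_distributive_iff subspace_orthogonal_comp V' add.commute)
  have AC: "subspace (A \<inter> C)" "closed (A \<inter> C)" and BC: "subspace (B \<inter> C)" "closed (B \<inter> C)"
    using A B C by (auto simp: subspace_inter)
  have VC': "(A \<inter> C + B \<inter> C)\<^sup>\<bottom> = (A \<inter> C)\<^sup>\<bottom> \<inter> (B \<inter> C)\<^sup>\<bottom>"
    using AC BC by (intro orthogonal_comp_sum subspace_0)
  show ?thesis
  proof
    assume L: ?L
    have AC': "(A \<inter> C)\<^sup>\<bottom> = C\<^sup>\<bottom> + A\<^sup>\<bottom>" and BC': "(B \<inter> C)\<^sup>\<bottom> = C\<^sup>\<bottom> + B\<^sup>\<bottom>"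
      using L A B C by (simp_all add: orthogonal_comp_Int add.commute)
    then have eq: "V\<^sup>\<bottom> + C\<^sup>\<bottom> = (A \<inter> C + B \<inter> C)\<^sup>\<bottom>"
      using L dual_iff VC' by metis
    then have closed_VC: "closed (V + C)"
      using closed_orthogonal_comp_sum_iff[OF V C] closed_orthogonal_comp by metis
    \<comment> \<open>Both copies of \<open>C\<^sup>\<bottom>\<close> merge, leaving the triple sum
      that is closed by hypothesis. So \<open>A \<inter> C + B \<inter> C\<close> is closed and can
      be recovered from its complement.\<close>
    have "(A \<inter> C)\<^sup>\<bottom> + (B \<inter> C)\<^sup>\<bottom> = A\<^sup>\<bottom> + B\<^sup>\<bottom> + (C\<^sup>\<bottom> + C\<^sup>\<bottom>)"
      unfolding AC' BC' by (simp add: ac_simps)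
    then have "closed (A \<inter> C + B \<inter> C)"
      using closed_orthogonal_comp_sum_iff[OF AC BC] closed_sum
      by (simp add: subspace_absorb_sum subspace_orthogonal_comp)
    moreover have "(V \<inter> C)\<^sup>\<bottom> = (A \<inter> C + B \<inter> C)\<^sup>\<bottom>"
      using orthogonal_comp_Int[OF V C closed_VC] eq by simp
    ultimately have "V \<inter> C = A \<inter> C + B \<inter> C"
      using orthogonal_comp_closed_subspace V C AC BC
      by (metis closed_Int subspace_inter subspace_set_plus)
    with closed_VC show ?R
      by (simp add: V_def)
  next
    assume R: ?R
    then have closed_VC: "closed (V + C)" and VC: "V \<inter> C = A \<inter> C + B \<inter> C"
      by (simp_all add: V_def)
    have eq: "V\<^sup>\<bottom> + C\<^sup>\<bottom> = (A \<inter> C)\<^sup>\<bottom> \<inter> (B \<inter> C)\<^sup>\<bottom>"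
      using orthogonal_comp_Int[OF V C closed_VC] VC VC' by simp
    have incl: "C\<^sup>\<bottom> + A\<^sup>\<bottom> \<subseteq> (A \<inter> C)\<^sup>\<bottom>" "C\<^sup>\<bottom> + B\<^sup>\<bottom> \<subseteq> (B \<inter> C)\<^sup>\<bottom>"
      by (intro subspace_sum_minimal orthogonal_comp_anti_mono subspace_orthogonal_comp; blast)+
    \<comment> \<open>Sandwich: the intersection of sums lies between
      \<open>V\<^sup>\<bottom> + C\<^sup>\<bottom>\<close> and the right-hand side of
      \<open>eq\<close>, which coincide.\<close>
    have "V\<^sup>\<bottom> + C\<^sup>\<bottom> \<subseteq> (C\<^sup>\<bottom> + A\<^sup>\<bottom>) \<inter> (C\<^sup>\<bottom> + B\<^sup>\<bottom>)"
      unfolding V' by (auto simp: set_plus_def) (metis add.commute)+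
    then have "(C\<^sup>\<bottom> + A\<^sup>\<bottom>) \<inter> (C\<^sup>\<bottom> + B\<^sup>\<bottom>) = V\<^sup>\<bottom> + C\<^sup>\<bottom>"
      using eq incl by blast
    \<comment> \<open>Stated for general \<open>X\<close> and \<open>Y\<close> to serve both orders
      of \<open>A\<close> and \<open>B\<close>. It is enough to show that
      \<open>X\<^sup>\<bottom> + C\<^sup>\<bottom>\<close> fills the closed set
      \<open>(X \<inter> C)\<^sup>\<bottom>\<close>.\<close>
    moreover have "closed (X + C)"
      if X: "subspace X" "closed X" and Y: "subspace Y" "closed Y"
        and sum: "closed (X\<^sup>\<bottom> + Y\<^sup>\<bottom> + C\<^sup>\<bottom>)"
        and eq: "(X\<^sup>\<bottom> \<inter> Y\<^sup>\<bottom>) + C\<^sup>\<bottom> = (X \<inter> C)\<^sup>\<bottom> \<inter> (Y \<inter> C)\<^sup>\<bottom>" for X Y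
    proof -
      have S: "subspace (X\<^sup>\<bottom> + Y\<^sup>\<bottom> + C\<^sup>\<bottom>)"
        by (intro subspace_set_plus subspace_orthogonal_comp)
      have "(X\<^sup>\<bottom> + Y\<^sup>\<bottom> + C\<^sup>\<bottom>)\<^sup>\<bottom> = X \<inter> Y \<inter> C"
        using X Y C by (simp add: orthogonal_comp_sum subspace_orthogonal_comp subspace_0
            subspace_set_plus orthogonal_comp_closed_subspace)
      then have sum_eq: "X\<^sup>\<bottom> + Y\<^sup>\<bottom> + C\<^sup>\<bottom> = (X \<inter> Y \<inter> C)\<^sup>\<bottom>"
        using orthogonal_comp_closed_subspace[OF S sum] by simp
      have "x \<in> X\<^sup>\<bottom> + C\<^sup>\<bottom>" if x: "x \<in> (X \<inter> C)\<^sup>\<bottom>" for x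
      proof -
        have "x \<in> (X \<inter> Y \<inter> C)\<^sup>\<bottom>"
          using x orthogonal_comp_anti_mono[of "X \<inter> Y \<inter> C" "X \<inter> C"] by blast
        then obtain a b c where x': "x = a + b + c" "a \<in> X\<^sup>\<bottom>" "b \<in> Y\<^sup>\<bottom>" "c \<in> C\<^sup>\<bottom>"
          unfolding sum_eq[symmetric] by (auto simp: set_plus_def)
        have sub: "X\<^sup>\<bottom> \<subseteq> (X \<inter> C)\<^sup>\<bottom>" "C\<^sup>\<bottom> \<subseteq> (X \<inter> C)\<^sup>\<bottom>" "Y\<^sup>\<bottom> \<subseteq> (Y \<inter> C)\<^sup>\<bottom>"
          by (auto intro!: orthogonal_comp_anti_mono)
        \<comment> \<open>This puts \<open>b\<close> in
          \<open>(X \<inter> C)\<^sup>\<bottom>\<close> as well as in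
          \<open>(Y \<inter> C)\<^sup>\<bottom>\<close>, so \<open>eq\<close> trades it for a sum
          from \<open>X\<^sup>\<bottom>\<close> and \<open>C\<^sup>\<bottom>\<close>.\<close>
        have "b = x - a - c"
          using x' by simp
        then have "b \<in> (X\<^sup>\<bottom> \<inter> Y\<^sup>\<bottom>) + C\<^sup>\<bottom>"
          unfolding eq using sub x x' by (metis IntI in_mono subspace_diff subspace_orthogonal_comp)
        then obtain a' c' where b: "b = a' + c'" "a' \<in> X\<^sup>\<bottom>" "c' \<in> C\<^sup>\<bottom>"
          by (auto simp: set_plus_def)
        have "(a + a') + (c + c') \<in> X\<^sup>\<bottom> + C\<^sup>\<bottom>"
          using b x' by (intro set_plus_intro subspace_add subspace_orthogonal_comp)
        then show ?thesis
          using b x' by (simp add: ac_simps)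
      qed
      moreover have "X\<^sup>\<bottom> + C\<^sup>\<bottom> \<subseteq> (X \<inter> C)\<^sup>\<bottom>"
        by (intro subspace_sum_minimal orthogonal_comp_anti_mono subspace_orthogonal_comp; blast)
      ultimately have "X\<^sup>\<bottom> + C\<^sup>\<bottom> = (X \<inter> C)\<^sup>\<bottom>"
        by blast
      then show ?thesis
        using closed_orthogonal_comp_sum_iff[OF X C] closed_orthogonal_comp by metis
    qed
    note this[OF A B closed_sum] this[OF B A]
    ultimately show ?L
      using dual_iff eq V' closed_sum by (simp add: add.commute Int_commute)
  qed
qed

section \<open>The relations determined by triples of subspaces\<close>

lemma P3_eq: "P3 M N S = {(m + n, m + s) |m n s. m \<in> M \<and> n \<in> N \<and> s \<in> S}"
  by (fastforce simp: P3_def P2_def set_plus_def)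

lemma P3_eq_diagonal_sum: "P3 M N S = (\<lambda>m. (m, m)) ` M + N \<times> S"
  by (fastforce simp: P3_eq set_plus_def)

lemma Range_P3: "Range (P3 M N S) = M + S" if "0 \<in> N"
  using that by (fastforce simp: P3_eq set_plus_def)

text \<open>The diagonal part cancels in \<open>(m + n) - (m + s)\<close>, leaving
  \<open>n - s\<close>.\<close>

lemma Range_id_minus_P3:
  assumes "0 \<in> M" "subspace S"
  shows "Range (id_minus_rel (P3 M N S)) = N + S"
proof
  show "Range (id_minus_rel (P3 M N S)) \<subseteq> N + S"
  proof
    fix z assume "z \<in> Range (id_minus_rel (P3 M N S))"
    then obtain m n s where z: "z = m + n - (m + s)" "n \<in> N" "s \<in> S"
      by (auto simp: id_minus_rel_def P3_eq)
    then have "n + - s \<in> N + S"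
      using assms subspace_neg by (intro set_plus_intro)
    then show "z \<in> N + S"
      using z by simp
  qed
  show "N + S \<subseteq> Range (id_minus_rel (P3 M N S))"
  proof
    fix x assume "x \<in> N + S"
    then obtain n s where x: "x = n + s" "n \<in> N" "s \<in> S"
      by (auto simp: set_plus_def)
    then have "(0 + n, 0 + - s) \<in> P3 M N S"
      unfolding P3_eq using assms subspace_neg by blast
    then have "(n, - s) \<in> P3 M N S"
      by simp
    then have "(n, n - - s) \<in> id_minus_rel (P3 M N S)"
      unfolding id_minus_rel_def by blast
    then show "x \<in> Range (id_minus_rel (P3 M N S))"
      using x by auto
  qed
qed

text \<open>The relation built from the closures lies between \<open>P3 M N S\<close> and the
  closure of \<open>P3 M N S\<close>.\<close>

lemma closure_P3: "closure (P3 (closure M) (closure N) (closure S)) = closure (P3 M N S)"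
  for M N S :: "'a::real_normed_vector set"
proof
  have "(\<lambda>m. (m, m)) ` closure M \<subseteq> closure ((\<lambda>m. (m, m)) ` M)"
    by (intro image_closure_subset continuous_intros) (auto simp: closure_subset)
  then have "P3 (closure M) (closure N) (closure S) \<subseteq> closure ((\<lambda>m. (m, m)) ` M) + closure (N \<times> S)"
    unfolding P3_eq_diagonal_sum closure_Times by (rule set_plus_mono2) simp
  also have "\<dots> \<subseteq> closure (P3 M N S)"
    unfolding P3_eq_diagonal_sum by (rule closure_sum)
  finally show "closure (P3 (closure M) (closure N) (closure S)) \<subseteq> closure (P3 M N S)"
    by (simp add: closure_minimal)
  have "P3 M N S \<subseteq> P3 (closure M) (closure N) (closure S)"
    using closure_subset by (force simp: P3_eq)
  then show "closure (P3 M N S) \<subseteq> closure (P3 (closure M) (closure N) (closure S))"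
    by (rule closure_mono)
qed

text \<open>Apply the closed-sum criterion in the product space to the diagonal copy of
  \<open>A\<close> and \<open>B \<times> C\<close>: the sum of their complements is the preimage of
  \<open>W\<close> under addition.\<close>

lemma closed_P3_iff:
  fixes A B C :: "'a::{real_inner,banach} set"
  assumes A: "subspace A" "closed A" and B: "subspace B" "closed B" and C: "subspace C" "closed C"
  shows "closed (P3 A B C) \<longleftrightarrow> closed (A\<^sup>\<bottom> + B\<^sup>\<bottom> + C\<^sup>\<bottom>)"
proof -
  define X where "X = (\<lambda>a. (a, a)) ` A"
  define W where "W = A\<^sup>\<bottom> + B\<^sup>\<bottom> + C\<^sup>\<bottom>"
  have X_eq: "X = {p. fst p \<in> A \<and> fst p = snd p}"
    by (auto simp: X_def)
  have X: "subspace X"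
    using A(1) unfolding X_eq by (auto simp: subspace_def)
  have "X = fst -` A \<inter> {p. fst p = snd p}"
    by (auto simp: X_def)
  moreover have "closed (fst -` A)"
    using A by (intro closed_vimage continuous_intros)
  moreover have "closed {p :: 'a \<times> 'a. fst p = snd p}"
    by (intro closed_Collect_eq continuous_intros)
  ultimately have "closed X"
    by (metis closed_Int)
  have Y: "subspace (B \<times> C)" "closed (B \<times> C)"
    using B C by (simp_all add: subspace_Times closed_Times)
  have X': "X\<^sup>\<bottom> = {p. fst p + snd p \<in> A\<^sup>\<bottom>}"
    by (auto simp: X_def orthogonal_comp_def orthogonal_def inner_add_right)
  have Y': "(B \<times> C)\<^sup>\<bottom> = (B\<^sup>\<bottom>) \<times> (C\<^sup>\<bottom>)"
    using subspace_0[OF B(1)] subspace_0[OF C(1)]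
    by (fastforce simp: orthogonal_comp_def orthogonal_def)
  have sum: "X\<^sup>\<bottom> + (B \<times> C)\<^sup>\<bottom> = (\<lambda>p. fst p + snd p) -` W"
  proof
    show "X\<^sup>\<bottom> + (B \<times> C)\<^sup>\<bottom> \<subseteq> (\<lambda>p. fst p + snd p) -` W"
    proof
      fix p assume "p \<in> X\<^sup>\<bottom> + (B \<times> C)\<^sup>\<bottom>"
      then obtain x y b c where p: "p = (x + b, y + c)" "x + y \<in> A\<^sup>\<bottom>" "b \<in> B\<^sup>\<bottom>" "c \<in> C\<^sup>\<bottom>"
        unfolding X' Y' by (auto simp: set_plus_def)
      then have "x + y + b + c \<in> W"
        unfolding W_def by (intro set_plus_intro)
      then show "p \<in> (\<lambda>p. fst p + snd p) -` W"
        using p by (simp add: ac_simps)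
    qed
    show "(\<lambda>p. fst p + snd p) -` W \<subseteq> X\<^sup>\<bottom> + (B \<times> C)\<^sup>\<bottom>"
    proof
      fix p assume "p \<in> (\<lambda>p. fst p + snd p) -` W"
      then obtain a b c where p: "fst p + snd p = a + b + c" "a \<in> A\<^sup>\<bottom>" "b \<in> B\<^sup>\<bottom>" "c \<in> C\<^sup>\<bottom>"
        by (auto simp: W_def set_plus_def)
      then have "fst p - b + (snd p - c) = a"
        by (simp add: algebra_simps)
      then have "(fst p - b, snd p - c) + (b, c) \<in> X\<^sup>\<bottom> + (B \<times> C)\<^sup>\<bottom>"
        unfolding X' Y' using p by (intro set_plus_intro) auto
      then show "p \<in> X\<^sup>\<bottom> + (B \<times> C)\<^sup>\<bottom>"
        by simp
    qed
  qed
  \<comment> \<open>Addition is continuous and has the continuous right inverse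
    \<open>x \<mapsto> (x, 0)\<close>, so closedness transfers both ways.\<close>
  have "closed ((\<lambda>p. fst p + snd p) -` W) \<longleftrightarrow> closed W"
  proof
    assume "closed ((\<lambda>p. fst p + snd p) -` W)"
    then have "closed ((\<lambda>x. (x, 0)) -` (\<lambda>p. fst p + snd p) -` W)"
      by (rule closed_vimage) (intro continuous_intros)
    then show "closed W"
      by (simp add: vimage_def)
  qed (rule closed_vimage, assumption, intro continuous_intros)
  then show ?thesis
    using closed_orthogonal_comp_sum_iff[OF X \<open>closed X\<close> Y]
    by (simp add: sum P3_eq_diagonal_sum flip: X_def W_def)
qed

section \<open>Idempotency and enlargement of triples\<close>

lemma idempotent_P3:
  assumes M: "subspace M" and N: "subspace N" and S: "subspace S"
    and "idempotency_condition M N S"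
  shows "idempotent_rel (P3 M N S)"
  unfolding idempotent_rel_def
proof
  have cond: "(M + N) \<inter> S = M \<inter> N"
    using assms by (simp add: idempotency_condition_def)
  show "P3 M N S O P3 M N S \<subseteq> P3 M N S"
  proof
    fix p assume "p \<in> P3 M N S O P3 M N S"
    then obtain m n s m' n' s' where p: "p = (m + n, m' + s')" "m + s = m' + n'"
        "m \<in> M" "n \<in> N" "s \<in> S" "m' \<in> M" "n' \<in> N" "s' \<in> S"
      by (auto simp: P3_eq)
    \<comment> \<open>The two forms of the intermediate vector place \<open>s\<close> in
      \<open>(M + N) \<inter> S\<close>. Then \<open>s\<close> and \<open>n'\<close> lie in
      \<open>M \<inter> N\<close>, which is contained in \<open>S\<close>, and
      \<open>m' + s'\<close> can be rewritten with first summand \<open>m\<close>.\<close>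
    have "(m' - m) + n' \<in> M + N"
      using M p by (intro set_plus_intro subspace_diff)
    moreover have "(m' - m) + n' = s"
      using p by (simp add: algebra_simps)
    ultimately have "s \<in> M \<inter> N"
      using cond p by auto
    moreover have "n' = m - m' + s"
      using p by (simp add: algebra_simps)
    ultimately have "n' \<in> M \<inter> N"
      using M p by (metis IntD1 IntI subspace_add subspace_diff)
    then have "n' \<in> S"
      using cond by blast
    then have "s - n' + s' \<in> S"
      using S p by (simp add: subspace_add subspace_diff)
    moreover have "m' + s' = m + (s - n' + s')"
      using p by (simp add: algebra_simps)
    ultimately show "p \<in> P3 M N S"
      using p unfolding P3_eq by blast
  qed
  show "P3 M N S \<subseteq> P3 M N S O P3 M N S"
  proof
    fix p assume "p \<in> P3 M N S"
    then obtain m n s where p: "p = (m + n, m + s)" "m \<in> M" "n \<in> N" "s \<in> S"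
      by (auto simp: P3_eq)
    \<comment> \<open>The pair factors through the intermediate vector \<open>m\<close>.\<close>
    then have "(m + n, m + 0) \<in> P3 M N S" "(m + 0, m + s) \<in> P3 M N S"
      unfolding P3_eq using subspace_0[OF N] subspace_0[OF S] by blast+
    then show "p \<in> P3 M N S O P3 M N S"
      using p by auto
  qed
qed

text \<open>Each added piece belongs to the other two subspaces and can be redistributed among the
  summands without changing the pair.\<close>

lemma P3_enlarge:
  assumes A: "subspace A" and B: "subspace B" and C: "subspace C"
  shows "P3 (A + (B \<inter> C)) (B + (A \<inter> C)) (C + (A \<inter> B)) = P3 A B C" (is "?L = _")
proof
  show "?L \<subseteq> P3 A B C"
  proof
    fix p assume "p \<in> ?L"
    then obtain a g b d c k where p: "p = (a + g + (b + d), a + g + (c + k))"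
        "a \<in> A" "g \<in> B" "g \<in> C" "b \<in> B" "d \<in> A" "d \<in> C" "c \<in> C" "k \<in> A" "k \<in> B"
      by (auto simp: P3_eq set_plus_def)
    then have "a + d + k \<in> A" "b + g - k \<in> B" "c + g - d \<in> C"
      using A B C by (simp_all add: subspace_add subspace_diff)
    moreover have "p = (a + d + k + (b + g - k), a + d + k + (c + g - d))"
      using p by (simp add: algebra_simps)
    ultimately show "p \<in> P3 A B C"
      unfolding P3_eq by blast
  qed
  have "X \<subseteq> X + Y" if "subspace Y" for X Y :: "'a set"
    using set_plus_intro[OF _ subspace_0[OF that]] by fastforce
  then have "A \<subseteq> A + (B \<inter> C)" "B \<subseteq> B + (A \<inter> C)" "C \<subseteq> C + (A \<inter> B)"
    using A B C by (simp_all add: subspace_inter)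
  then show "P3 A B C \<subseteq> ?L"
    unfolding P3_eq by blast
qed

text \<open>Together with \<open>P3_enlarge\<close>, this represents \<open>P3 A B C\<close> by a
  triple to which \<open>idempotent_P3\<close> applies.\<close>

lemma idempotency_condition_enlarge:
  assumes A: "subspace A" and B: "subspace B" and C: "subspace C"
    and dist: "(A + B) \<inter> C \<subseteq> (A \<inter> C) + (B \<inter> C)"
  shows "idempotency_condition (A + (B \<inter> C)) (B + (A \<inter> C)) (C + (A \<inter> B))"
  unfolding idempotency_condition_def
proof
  show "(A + (B \<inter> C) + (B + (A \<inter> C))) \<inter> (C + (A \<inter> B)) \<subseteq> (A + (B \<inter> C)) \<inter> (B + (A \<inter> C))"
  proof
    fix x assume "x \<in> (A + (B \<inter> C) + (B + (A \<inter> C))) \<inter> (C + (A \<inter> B))"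
    then have x: "x \<in> A + (B \<inter> C) + (B + (A \<inter> C))" "x \<in> C + (A \<inter> B)"
      by blast+
    obtain a g b d where "x = a + g + (b + d)"
        "a \<in> A" "g \<in> B" "g \<in> C" "b \<in> B" "d \<in> A" "d \<in> C"
      using x(1) by (auto simp: set_plus_def)
    moreover obtain c k where "x = c + k" "c \<in> C" "k \<in> A" "k \<in> B"
      using x(2) by (auto simp: set_plus_def)
    ultimately have x: "x = a + g + (b + d)" "x = c + k"
        "a \<in> A" "g \<in> B" "g \<in> C" "b \<in> B" "d \<in> A" "d \<in> C" "c \<in> C" "k \<in> A" "k \<in> B"
      by blast+
    \<comment> \<open>Subtracting \<open>k\<close> from \<open>x\<close> leaves \<open>c\<close>,
      now seen in \<open>(A + B) \<inter> C\<close>, where \<open>dist\<close> applies.\<close>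
    have "(a + d - k) + (b + g) \<in> A + B"
      using A B x by (intro set_plus_intro subspace_add subspace_diff)
    moreover have c: "(a + d - k) + (b + g) = c"
      using x by (simp add: algebra_simps)
    ultimately obtain d' g' where c: "c = d' + g'" "d' \<in> A" "d' \<in> C" "g' \<in> B" "g' \<in> C"
      using dist x by (auto simp: set_plus_def) blast
    have "(d' + k) + g' \<in> A + (B \<inter> C)" "(g' + k) + d' \<in> B + (A \<inter> C)"
      using A B c x by (auto intro!: set_plus_intro subspace_add)
    then show "x \<in> (A + (B \<inter> C)) \<inter> (B + (A \<inter> C))"
      using c x by (simp add: ac_simps)
  qed
  show "(A + (B \<inter> C)) \<inter> (B + (A \<inter> C)) \<subseteq> (A + (B \<inter> C) + (B + (A \<inter> C))) \<inter> (C + (A \<inter> B))"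
  proof
    fix x assume x: "x \<in> (A + (B \<inter> C)) \<inter> (B + (A \<inter> C))"
    then obtain a g where "x = a + g" "a \<in> A" "g \<in> B" "g \<in> C"
      by (auto simp: set_plus_def)
    moreover obtain b d where "x = b + d" "b \<in> B" "d \<in> A" "d \<in> C"
      using x by (auto simp: set_plus_def)
    ultimately have ag: "x = a + g" "x = b + d"
        "a \<in> A" "g \<in> B" "g \<in> C" "b \<in> B" "d \<in> A" "d \<in> C"
      by blast+
    have "a - d = b - g"
      using ag by (simp add: algebra_simps)
    then have "a - d \<in> A \<inter> B"
      using A B ag by (metis IntI subspace_diff)
    \<comment> \<open>This is a rearrangement of \<open>x = a + g\<close>.\<close>
    then have "(d + g) + (a - d) \<in> C + (A \<inter> B)"
      using C ag by (intro set_plus_intro subspace_add)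
    moreover have "0 \<in> B + (A \<inter> C)"
      using A B C by (intro subspace_0 subspace_set_plus subspace_inter)
    then have "x + 0 \<in> A + (B \<inter> C) + (B + (A \<inter> C))"
      using x by (intro set_plus_intro) auto
    ultimately show "x \<in> (A + (B \<inter> C) + (B + (A \<inter> C))) \<inter> (C + (A \<inter> B))"
      using ag by (simp add: algebra_simps)
  qed
qed

section \<open>The adjoint\<close>

lemma csubspace_imp_subspace: "csubspace M \<Longrightarrow> subspace M"
  by (simp add: subspace_def complex_vector.subspace_def scaleR_scaleC)

lemma corth_iff: "x \<in> corth M \<longleftrightarrow> (\<forall>y\<in>M. cinner y x = 0)"
  unfolding corth_def mem_Collect_eq by (metis cinner_commute complex_cnj_zero)

text \<open>A complex subspace contains \<open>\<i> *\<^sub>C y\<close> along with \<open>y\<close>,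
  so vanishing real parts force vanishing imaginary parts.\<close>

lemma corth_eq_orthogonal_comp:
  assumes "csubspace M"
  shows "corth M = M\<^sup>\<bottom>"
proof
  show "corth M \<subseteq> M\<^sup>\<bottom>"
    by (auto simp: corth_iff orthogonal_comp_def orthogonal_def inner_eq_Re_cinner)
  show "M\<^sup>\<bottom> \<subseteq> corth M"
  proof
    fix x assume x: "x \<in> M\<^sup>\<bottom>"
    have Re: "Re (cinner y x) = 0" if "y \<in> M" for y
      using x that by (simp add: orthogonal_comp_def orthogonal_def inner_eq_Re_cinner)
    have "cinner x y = 0" if "y \<in> M" for y
    proof -
      have "\<i> *\<^sub>C y \<in> M"
        using assms that complex_vector.subspace_scale by blast
      then have "Im (cinner y x) = 0"
        using Re[of "\<i> *\<^sub>C y"] by (simp add: cinner_scaleC_left)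
      then have "cinner y x = 0"
        using Re[OF that] by (simp add: complex_eq_iff)
      then show ?thesis
        using cinner_commute[of x y] by simp
    qed
    then show "x \<in> corth M"
      by (simp add: corth_def)
  qed
qed

lemma cinner_add_right: "cinner x (y + z) = cinner x y + cinner x z"
  using cinner_commute cinner_add_left by (metis complex_cnj_add)

lemma cinner_diff_right: "cinner x (y - z) = cinner x y - cinner x z"
  using cinner_add_right[of x "y - z" z] by simp

text \<open>The three conditions come from test pairs with only one of \<open>m\<close>,
  \<open>n\<close>, \<open>s\<close> nonzero; by additivity these suffice.\<close>

lemma adjoint_P3:
  assumes "0 \<in> M" "0 \<in> N" "0 \<in> S"
  shows "adjoint_rel (P3 M N S) = {(x, y). x \<in> corth S \<and> y \<in> corth N \<and> x - y \<in> corth M}"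
proof -
  have zero: "cinner 0 x = 0" for x :: 'a
    using cinner_add_left[of 0 0 x] by simp
  have "(\<forall>(f, g)\<in>P3 M N S. cinner g x = cinner f y) \<longleftrightarrow>
      x \<in> corth S \<and> y \<in> corth N \<and> x - y \<in> corth M" for x y
  proof
    assume L: "\<forall>(f, g)\<in>P3 M N S. cinner g x = cinner f y"
    have *: "cinner (m + s) x = cinner (m + n) y" if "m \<in> M" "n \<in> N" "s \<in> S" for m n s
      using L that unfolding P3_eq by blast
    have "cinner s x = 0" if "s \<in> S" for s
      using *[OF assms(1,2) that] by (simp add: zero)
    moreover have "cinner n y = 0" if "n \<in> N" for n
      using *[OF assms(1) that assms(3)] by (simp add: zero)
    moreover have "cinner m (x - y) = 0" if "m \<in> M" for m
      using *[OF that assms(2,3)] by (simp add: cinner_diff_right)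
    ultimately show "x \<in> corth S \<and> y \<in> corth N \<and> x - y \<in> corth M"
      by (simp add: corth_iff)
  qed (auto simp: P3_eq corth_iff cinner_add_left cinner_diff_right)
  then show ?thesis
    unfolding adjoint_rel_def by simp
qed

text \<open>The relation is \<open>P2 B A\<close> restricted to arguments in \<open>C\<close>. Its
  square is always contained in it; the other inclusion asks for an intermediate vector in
  \<open>B \<inter> C\<close>, that is, a splitting of \<open>x\<close> along
  \<open>A \<inter> C\<close> and \<open>B \<inter> C\<close>.\<close>

lemma idempotent_rel_restricted_P2_iff:
  assumes A: "subspace A" and B: "subspace B" and C: "subspace C"
  shows "idempotent_rel {(x, y). x \<in> C \<and> y \<in> B \<and> x - y \<in> A} \<longleftrightarrow>
    (A + B) \<inter> C = (A \<inter> C) + (B \<inter> C)" (is "idempotent_rel ?R \<longleftrightarrow> _")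
proof
  assume idem: "idempotent_rel ?R"
  have "x \<in> (A \<inter> C) + (B \<inter> C)" if "x \<in> (A + B) \<inter> C" for x
  proof -
    obtain a b where x: "x = a + b" "a \<in> A" "b \<in> B" "x \<in> C"
      using \<open>x \<in> (A + B) \<inter> C\<close> by (auto simp: set_plus_def)
    then have "(x, b) \<in> ?R"
      by simp
    then have "(x, b) \<in> ?R O ?R"
      using idem by (simp add: idempotent_rel_def)
    then obtain y where "x - y \<in> A" "y \<in> B" "y \<in> C"
      by auto
    moreover have "x - y \<in> C"
      using C x \<open>y \<in> C\<close> by (simp add: subspace_diff)
    ultimately show ?thesis
      using set_plus_intro[of "x - y" "A \<inter> C" y "B \<inter> C"] by simp
  qed
  moreover have "(A \<inter> C) + (B \<inter> C) \<subseteq> (A + B) \<inter> C"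
    using C by (auto simp: set_plus_def subspace_add)
  ultimately show "(A + B) \<inter> C = (A \<inter> C) + (B \<inter> C)"
    by blast
next
  assume dist: "(A + B) \<inter> C = (A \<inter> C) + (B \<inter> C)"
  have "?R O ?R \<subseteq> ?R"
  proof
    fix p assume "p \<in> ?R O ?R"
    then obtain x y z where p: "p = (x, z)" "x \<in> C" "z \<in> B" "x - y \<in> A" "y - z \<in> A"
      by auto
    then show "p \<in> ?R"
      using subspace_add[OF A p(4,5)] by simp
  qed
  moreover have "?R \<subseteq> ?R O ?R"
  proof
    fix p assume "p \<in> ?R"
    then obtain x z where p: "p = (x, z)" "x \<in> C" "z \<in> B" "x - z \<in> A"
      by auto
    then have "x \<in> (A \<inter> C) + (B \<inter> C)"
      using set_plus_intro[of "x - z" A z B] dist by auto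
    then obtain d g where dg: "x = d + g" "d \<in> A" "d \<in> C" "g \<in> B" "g \<in> C"
      by (auto simp: set_plus_def)
    then have "g - z \<in> A"
      using subspace_diff[OF A p(4), of d] by (simp add: algebra_simps)
    then have "(x, g) \<in> ?R" "(g, z) \<in> ?R"
      using dg p by simp_all
    then show "p \<in> ?R O ?R"
      using p by blast
  qed
  ultimately show "idempotent_rel ?R"
    by (simp add: idempotent_rel_def)
qed

section \<open>Translation of both conditions to the closures and their complements\<close>

theorem theorem5p22:
  fixes M N S :: "'a::separable_chilbert_space set"
    and E :: "('a \<times> 'a) set"
  assumes "csubspace M" and "csubspace N" and "csubspace S"
    and "idempotency_condition M N S"
    and "E = P3 M N S"
  shows "((idempotent_rel (adjoint_rel E) \<and>
        closure E = P2 (closure M) (closure N) + {0} \<times> closure S \<and>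
        closed (Range (closure E)) \<and>
        closed (Range (id_minus_rel (closure E))))
      \<longleftrightarrow>
      (closed (corth M + corth N + corth S) \<and>
        closed (closure (M + N) + closure S) \<and>
        closure (M + N) \<inter> closure S =
          (closure M \<inter> closure S) + (closure N \<inter> closure S))) \<and>
    (closed (corth M + corth N + corth S) \<and>
        closed (closure (M + N) + closure S) \<and>
        closure (M + N) \<inter> closure S =
          (closure M \<inter> closure S) + (closure N \<inter> closure S)
      \<longrightarrow>
      idempotent_rel (closure E) \<and>
      idempotency_condition
        (closure M + (closure N \<inter> closure S))
        (closure N + (closure M \<inter> closure S))
        (closure S + (closure M \<inter> closure N)) \<and>
      closure E =
        P3 (closure M + (closure N \<inter> closure S))
           (closure N + (closure M \<inter> closure S))
           (closure S + (closure M \<inter> closure N)))"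
proof -
  define A B C where "A = closure M" and "B = closure N" and "C = closure S"
  have M: "subspace M" and N: "subspace N" and S: "subspace S"
    using assms csubspace_imp_subspace by blast+
  have A: "subspace A" "closed A" and B: "subspace B" "closed B" and C: "subspace C" "closed C"
    using M N S by (simp_all add: A_def B_def C_def subspace_closure)
  have corth: "corth M = A\<^sup>\<bottom>" "corth N = B\<^sup>\<bottom>" "corth S = C\<^sup>\<bottom>"
    using assms by (simp_all add: corth_eq_orthogonal_comp A_def B_def C_def orthogonal_comp_closure)
  have sum: "closure (M + N) = closure (A + B)"
    using closure_minimal[OF closure_sum[of M N]] closure_mono[of "M + N" "A + B"]
      set_plus_mono2[OF closure_subset[of M] closure_subset[of N]]
    by (auto simp: A_def B_def)
  have closure_E: "closure E = closure (P3 A B C)"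
    using assms by (simp add: A_def B_def C_def closure_P3)
  then have closed_iff: "closure E = P3 A B C \<longleftrightarrow> closed (A\<^sup>\<bottom> + B\<^sup>\<bottom> + C\<^sup>\<bottom>)"
    by (metis closed_P3_iff[OF A B C] closure_closed closed_closure)
  \<comment> \<open>The adjoint sees \<open>M\<close>, \<open>N\<close>, \<open>S\<close> only
    through their complements, which are those of the closures.\<close>
  have adjoint: "idempotent_rel (adjoint_rel E) \<longleftrightarrow>
      (A\<^sup>\<bottom> + B\<^sup>\<bottom>) \<inter> C\<^sup>\<bottom> = (A\<^sup>\<bottom> \<inter> C\<^sup>\<bottom>) + (B\<^sup>\<bottom> \<inter> C\<^sup>\<bottom>)"
    using M N S assms(5) corth
    by (simp add: adjoint_P3 subspace_0 idempotent_rel_restricted_P2_iff subspace_orthogonal_comp)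
  have ranges: "Range (closure E) = A + C" "Range (id_minus_rel (closure E)) = B + C"
    if "closure E = P3 A B C"
    using that A B C by (simp_all add: Range_P3 Range_id_minus_P3 subspace_0)
  have enlarge: "idempotent_rel (P3 A B C) \<and>
      idempotency_condition (A + (B \<inter> C)) (B + (A \<inter> C)) (C + (A \<inter> B))"
    if "closure (A + B) \<inter> C = (A \<inter> C) + (B \<inter> C)"
  proof -
    have "(A + B) \<inter> C \<subseteq> (A \<inter> C) + (B \<inter> C)"
      using that closure_subset by blast
    note cond = idempotency_condition_enlarge[OF A(1) B(1) C(1) this]
    \<comment> \<open>Idempotency is obtained for the enlarged triple, whose condition is
      \<open>cond\<close>, and carried back to \<open>P3 A B C\<close>.\<close>
    then have "idempotent_rel (P3 (A + (B \<inter> C)) (B + (A \<inter> C)) (C + (A \<inter> B)))"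
      using A B C by (intro idempotent_P3 subspace_set_plus subspace_inter)
    with cond show ?thesis
      using P3_enlarge[OF A(1) B(1) C(1)] by simp
  qed
  \<comment> \<open>Either condition makes the triple sum of complements closed, by
    \<open>closed_iff\<close>. This identifies the ranges and supplies the premise of
    \<open>distributive_complements_iff\<close>, which settles the rest of the equivalence.\<close>
  show ?thesis
    unfolding P3_def[symmetric] A_def[symmetric] B_def[symmetric] C_def[symmetric] corth sum
      P3_enlarge[OF A(1) B(1) C(1)]
    using closed_iff adjoint ranges enlarge distributive_complements_iff[OF A B C] by metis
qed

end
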